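(* Let $p\equiv 1\pmod 4$ be a prime and $L_p=(p-1)(p-5)/96$. Let $X=\{(a,b)\in V\times V : a<b<\overline{a}<\overline{b}\}$, $Y=\{(a,b)\in V\times V : a<\overline{a}<b<\overline{b}\}$, $Z=\{(a,b)\in V\times V : a<b<\overline{b}<\overline{a}\}$. Then $|Y|=L_p$ and $|X|+|Z|=2L_p$.
   Context: For an integer $x$, $\{x\}_p$ denotes the least nonnegative residue of $x$ modulo $p$, and $\widetilde{x}=p-\{x\}_p$ if $\{x\}_p>p/2$, while $\widetilde{x}=\{x\}_p$ if $\{x\}_p<p/2$. Let $t=\prod_{x=1}^{(p-1)/2}x$. Let $V=\{x : 1\le x\le (p-1)/2,\ x<\widetilde{tx}\}$, and for $a\in V$ put $\overline{a}=\widetilde{ta}$. *)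

theory Defs
  imports Complex_Main "HOL-Number_Theory.Number_Theory"
begin

text \<open>
  The tie \<open>x mod p = p / 2\<close> cannot occur for odd \<open>p\<close>, so a single conditional covers both cases.
\<close>

definition tilde :: "int \<Rightarrow> int \<Rightarrow> int" where
  "tilde p x = (if real_of_int (x mod p) > real_of_int p / 2 then p - x mod p else x mod p)"

definition half_fact :: "int \<Rightarrow> int" where
  "half_fact p = (\<Prod>x\<in>{1..(p - 1) div 2}. x)"

definition bar :: "int \<Rightarrow> int \<Rightarrow> int" where
  "bar p a = tilde p (half_fact p * a)"

definition V_set :: "int \<Rightarrow> int set" where
  "V_set p = {x. 1 \<le> x \<and> x \<le> (p - 1) div 2 \<and> x < tilde p (half_fact p * x)}"

definition X_set :: "int \<Rightarrow> (int \<times> int) set" where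
  "X_set p = {(a, b) \<in> V_set p \<times> V_set p. a < b \<and> b < bar p a \<and> bar p a < bar p b}"

definition Y_set :: "int \<Rightarrow> (int \<times> int) set" where
  "Y_set p = {(a, b) \<in> V_set p \<times> V_set p. a < bar p a \<and> bar p a < b \<and> b < bar p b}"

definition Z_set :: "int \<Rightarrow> (int \<times> int) set" where
  "Z_set p = {(a, b) \<in> V_set p \<times> V_set p. a < b \<and> b < bar p b \<and> bar p b < bar p a}"

definition L :: "int \<Rightarrow> real" where
  "L p = (real_of_int p - 1) * (real_of_int p - 5) / 96"

end

theory Submission
  imports Defs
begin

text \<open>
  Put \<open>n = (p - 1) div 2\<close> and \<open>t = half_fact p\<close>. By Wilson's theorem \<open>t\<^sup>2 \<equiv> -1\<close>, so \<open>bar p\<close> is a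
  fixed-point-free involution of \<open>{1..n}\<close>; regard its orbits as \<open>n div 2\<close> chords \<open>{a, bar p a}\<close>.
  All pairs of chords are counted by \<open>X\<close>, \<open>Y\<close> and \<open>Z\<close> together. A pair of crossing or nested chords
  gives exactly two incidences of an endpoint lying strictly inside another chord, so the number of
  these incidences is \<open>2 * (|X| + |Z|)\<close>. Hence only the sum \<open>D\<close> of \<open>\<bar>bar p x - x\<bar>\<close> over \<open>{1..n}\<close> is
  needed.

  Up to sign, \<open>bar p x - x\<close> and \<open>bar p x + x\<close> are congruent to \<open>(t - 1) * x\<close> and \<open>(t + 1) * x\<close> in
  some order, so \<open>\<bar>bar p x - x\<bar>\<close> and \<open>tilde p (bar p x + x)\<close> together run twice through \<open>{1..n}\<close>.
  The function \<open>y * (p - y)\<close> takes the same value at \<open>bar p x + x\<close> and at its absolute residue.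
  Summing it over both families, and over \<open>{1..n}\<close> twice, gives \<open>p * D = 2 * (1\<^sup>2 + \<dots> + n\<^sup>2)\<close>,
  that is, \<open>3 * D = n * (n + 1)\<close>.
\<close>

section \<open>Chord diagrams\<close>

lemma card_less_pairs:
  fixes A :: "'a::linorder set"
  assumes "finite A"
  shows "card {(a, b) \<in> A \<times> A. a < b} = card A choose 2"
  using assms
proof (induction A rule: finite_linorder_max_induct)
  case empty
  show ?case by simp
next
  case (insert m A)
  let ?P = "{(a, b) \<in> A \<times> A. a < b}"
  have "finite ?P"
    by (rule finite_subset[of _ "A \<times> A"]) (use insert.hyps in auto)
  moreover have "?P \<inter> A \<times> {m} = {}"
    using insert.hyps(2) by auto
  moreover have "{(a, b) \<in> insert m A \<times> insert m A. a < b} = ?P \<union> A \<times> {m}"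
    using insert.hyps(2) by force
  moreover have "m \<notin> A"
    using insert.hyps(2) by blast
  ultimately show ?case
    using insert.hyps(1) insert.IH
    by (simp add: card_Un_disjoint card_cartesian_product numeral_2_eq_2)
qed

locale chord_diagram =
  fixes A :: "'a::linorder set" and s :: "'a \<Rightarrow> 'a"
  assumes finite_points [simp]: "finite A"
    and partner_in: "x \<in> A \<Longrightarrow> s x \<in> A"
    and partner_partner: "x \<in> A \<Longrightarrow> s (s x) = x"
    and partner_neq: "x \<in> A \<Longrightarrow> s x \<noteq> x"
begin

definition left_endpoints :: "'a set" where
  "left_endpoints = {x \<in> A. x < s x}"

definition crossing :: "('a \<times> 'a) set" where
  "crossing = {(a, b) \<in> left_endpoints \<times> left_endpoints. a < b \<and> b < s a \<and> s a < s b}"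

definition separated :: "('a \<times> 'a) set" where
  "separated = {(a, b) \<in> left_endpoints \<times> left_endpoints. s a < b}"

definition nested :: "('a \<times> 'a) set" where
  "nested = {(a, b) \<in> left_endpoints \<times> left_endpoints. a < b \<and> s b < s a}"

lemmas pair_defs = crossing_def separated_def nested_def

lemma left_endpoints_subset: "left_endpoints \<subseteq> A"
  by (auto simp: left_endpoints_def)

lemma finite_left_endpoints [simp]: "finite left_endpoints"
  using finite_subset[OF left_endpoints_subset] by simp

lemma finite_pairs [simp]: "finite crossing" "finite separated" "finite nested"
  by (rule finite_subset[of _ "left_endpoints \<times> left_endpoints"]; auto simp: pair_defs)+

lemma left_endpoint_less: "a \<in> left_endpoints \<Longrightarrow> a < s a"
  by (simp add: left_endpoints_def)

lemma partner_eq_iff: "x \<in> A \<Longrightarrow> y \<in> A \<Longrightarrow> s x = s y \<longleftrightarrow> x = y"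
  by (metis partner_partner)

lemma partner_neq_left_endpoint: "a \<in> left_endpoints \<Longrightarrow> b \<in> left_endpoints \<Longrightarrow> s a \<noteq> b"
  using partner_partner by (force simp: left_endpoints_def)

lemma sum_chords:
  fixes f :: "'a \<Rightarrow> 'b::comm_monoid_add"
  shows "(\<Sum>x\<in>A. f x) = (\<Sum>a\<in>left_endpoints. f a + f (s a))"
proof -
  have "(\<Sum>x\<in>A - left_endpoints. f x) = (\<Sum>a\<in>left_endpoints. f (s a))"
    by (rule sum.reindex_bij_witness[of _ s s])
      (auto simp: left_endpoints_def partner_in partner_partner dest: partner_neq)
  then show ?thesis
    using sum.subset_diff[OF left_endpoints_subset finite_points, of f]
    by (simp add: sum.distrib add.commute)
qed

lemma card_points: "card A = 2 * card left_endpoints"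
  using sum_chords[of "\<lambda>_. 1 :: nat"] by simp

lemma card_pairs: "card crossing + card separated + card nested = card left_endpoints choose 2"
proof -
  have "a < b \<longleftrightarrow> (a, b) \<in> crossing \<union> separated \<union> nested"
    if "a \<in> left_endpoints" "b \<in> left_endpoints" for a b
  proof -
    have "a < s a" "b < s b" "s a \<noteq> b" "s a = s b \<longleftrightarrow> a = b"
      using that left_endpoint_less partner_neq_left_endpoint partner_eq_iff[of a b]
        left_endpoints_subset by blast+
    with that show ?thesis by (auto simp: pair_defs)
  qed
  then have "{(a, b) \<in> left_endpoints \<times> left_endpoints. a < b} = crossing \<union> separated \<union> nested"
    by (auto simp: pair_defs)
  moreover have "crossing \<inter> separated = {}" "(crossing \<union> separated) \<inter> nested = {}"
    by (auto simp: pair_defs dest: left_endpoint_less)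
  ultimately show ?thesis
    using card_less_pairs[OF finite_left_endpoints] by (simp add: card_Un_disjoint)
qed

lemma left_endpoints_inside:
  "(SIGMA a:left_endpoints. {b \<in> left_endpoints. a < b \<and> b < s a}) = crossing \<union> nested"
proof -
  have "a < b \<and> b < s a \<longleftrightarrow> (a, b) \<in> crossing \<or> (a, b) \<in> nested"
    if "a \<in> left_endpoints" "b \<in> left_endpoints" for a b
  proof -
    have "b < s b" "s a = s b \<longleftrightarrow> a = b"
      using that left_endpoint_less partner_eq_iff[of a b] left_endpoints_subset by blast+
    with that show ?thesis by (auto simp: pair_defs)
  qed
  then show ?thesis by (auto simp: pair_defs)
qed

lemma right_endpoints_inside:
  "(SIGMA a:left_endpoints. {b \<in> left_endpoints. a < s b \<and> s b < s a}) = crossing\<inverse> \<union> nested"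
proof -
  have "a < s b \<and> s b < s a \<longleftrightarrow> (b, a) \<in> crossing \<or> (a, b) \<in> nested"
    if "a \<in> left_endpoints" "b \<in> left_endpoints" for a b
    using that left_endpoint_less[of a] left_endpoint_less[of b]
    by (cases a b rule: linorder_cases) (auto simp: pair_defs)
  then show ?thesis by (auto simp: pair_defs)
qed

lemma sum_card_inside:
  "(\<Sum>a\<in>left_endpoints. card {x \<in> A. a < x \<and> x < s a}) = 2 * (card crossing + card nested)"
proof -
  have "card {x \<in> A. a < x \<and> x < s a} = card {b \<in> left_endpoints. a < b \<and> b < s a}
      + card {b \<in> left_endpoints. a < s b \<and> s b < s a}" for a
    using sum_chords[of "\<lambda>x. of_bool (a < x \<and> x < s a) :: nat"]
    by (simp add: sum.distrib Int_def)
  then have "(\<Sum>a\<in>left_endpoints. card {x \<in> A. a < x \<and> x < s a})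
      = card (crossing \<union> nested) + card (crossing\<inverse> \<union> nested)"
    by (simp add: sum.distrib flip: left_endpoints_inside right_endpoints_inside)
  moreover have "crossing \<inter> nested = {}" "crossing\<inverse> \<inter> nested = {}"
    by (auto simp: pair_defs)
  ultimately show ?thesis by (simp add: card_Un_disjoint)
qed

end

locale interval_chord_diagram = chord_diagram "{m..n}" s for m n :: int and s
begin

lemma sum_abs_partner_diff:
  "(\<Sum>x\<in>{m..n}. \<bar>s x - x\<bar>) = 4 * int (card crossing + card nested) + int (card {m..n})"
proof -
  have "int (card {x \<in> {m..n}. a < x \<and> x < s a}) = s a - a - 1" if "a \<in> left_endpoints" for a
  proof -
    have "{x \<in> {m..n}. a < x \<and> x < s a} = {a<..<s a}"
      using that partner_in[of a] by (auto simp: left_endpoints_def)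
    then show ?thesis using left_endpoint_less[OF that] by simp
  qed
  then have "(\<Sum>a\<in>left_endpoints. s a - a - 1) = 2 * int (card crossing + card nested)"
    using arg_cong[OF sum_card_inside, of int] by simp
  moreover have "(\<Sum>x\<in>{m..n}. \<bar>s x - x\<bar>) = 2 * (\<Sum>a\<in>left_endpoints. s a - a)"
    unfolding sum_chords sum_distrib_left
    by (rule sum.cong) (auto simp: left_endpoints_def partner_partner)
  ultimately show ?thesis
    unfolding card_points by (simp add: sum_subtractf)
qed

end

section \<open>Absolute least residues\<close>

lemma tilde_eq_min: "tilde p x = min (x mod p) (p - x mod p)"
proof -
  have "real_of_int (x mod p) > real_of_int p / 2 \<longleftrightarrow> 2 * (x mod p) > p" by linarith
  then show ?thesis by (simp add: tilde_def)
qed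

lemma tilde_cong: "[x = y] (mod p) \<Longrightarrow> tilde p x = tilde p y"
  by (simp add: tilde_def cong_def)

lemma cong_tilde: "[tilde p x = x] (mod p) \<or> [tilde p x = - x] (mod p)"
  by (auto simp: tilde_def cong_def mod_simps)

lemma tilde_minus: "tilde p (- x) = tilde p x"
  by (auto simp: tilde_eq_min zmod_zminus1_eq_if)

lemma tilde_abs: "tilde p \<bar>x\<bar> = tilde p x"
  by (simp add: abs_if tilde_minus)

lemma tilde_mult_tilde: "tilde p (c * tilde p x) = tilde p (c * x)"
  using cong_tilde[of p x]
proof
  assume "[tilde p x = x] (mod p)"
  then show ?thesis by (intro tilde_cong cong_scalar_left)
next
  assume "[tilde p x = - x] (mod p)"
  then have "tilde p (c * tilde p x) = tilde p (c * - x)"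
    by (intro tilde_cong cong_scalar_left)
  then show ?thesis by (simp add: tilde_minus)
qed

lemma tilde_diff_add_tilde:
  fixes f :: "int \<Rightarrow> 'b::ab_semigroup_add"
  shows "f (tilde p (tilde p y - x)) + f (tilde p (tilde p y + x))
    = f (tilde p (y - x)) + f (tilde p (y + x))"
  using cong_tilde[of p y]
proof
  assume "[tilde p y = y] (mod p)"
  then have "tilde p (tilde p y - x) = tilde p (y - x)" "tilde p (tilde p y + x) = tilde p (y + x)"
    by (auto intro!: tilde_cong cong_diff cong_add)
  then show ?thesis by simp
next
  assume cong: "[tilde p y = - y] (mod p)"
  have "tilde p (tilde p y - x) = tilde p (- (y + x))"
    using cong_diff[OF cong cong_refl[of x]] by (intro tilde_cong) simp
  moreover have "tilde p (tilde p y + x) = tilde p (- (y - x))"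
    using cong_add[OF cong cong_refl[of x]] by (intro tilde_cong) simp
  ultimately show ?thesis by (simp only: tilde_minus add.commute)
qed

context
  fixes p :: int
  assumes p_pos: "0 < p"
begin

lemma tilde_in_half_range: "tilde p x \<in> {0..p div 2}"
  using pos_mod_bound[OF p_pos, of x] pos_mod_sign[OF p_pos, of x]
  by (auto simp: tilde_eq_min min_def)

lemma tilde_eq_self:
  assumes "x \<in> {0..p div 2}"
  shows "tilde p x = x"
proof -
  have "x mod p = x" using assms p_pos by (intro mod_pos_pos_trivial) auto
  then show ?thesis using assms by (auto simp: tilde_eq_min)
qed

lemma tilde_eq_0_iff: "tilde p x = 0 \<longleftrightarrow> p dvd x"
  using pos_mod_bound[OF p_pos, of x] by (auto simp: tilde_eq_min min_def mod_eq_0_iff_dvd)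

lemma tilde_mult_diff_tilde:
  "x \<in> {0..<p} \<Longrightarrow> tilde p x * (p - tilde p x) = x * (p - x)"
  by (auto simp: tilde_def)

lemma tilde_mult_in_half_range:
  assumes "coprime c p" and x: "x \<in> {1..p div 2}"
  shows "tilde p (c * x) \<in> {1..p div 2}"
proof -
  have "\<not> p dvd x" using x p_pos by (auto dest: zdvd_imp_le)
  then have "\<not> p dvd c * x"
    using assms(1) by (simp add: coprime_dvd_mult_right_iff coprime_commute)
  then show ?thesis
    using tilde_in_half_range[of "c * x"] tilde_eq_0_iff[of "c * x"] by auto
qed

lemma tilde_mult_inverse:
  assumes "[u * v = 1] (mod p)" and "x \<in> {0..p div 2}"
  shows "tilde p (u * tilde p (v * x)) = x"
proof -
  have "tilde p (u * tilde p (v * x)) = tilde p (u * v * x)"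
    by (simp add: tilde_mult_tilde mult.assoc)
  also have "\<dots> = tilde p x"
    using cong_scalar_right[OF assms(1), of x] by (intro tilde_cong) simp
  finally show ?thesis using tilde_eq_self[OF assms(2)] by simp
qed

lemma bij_betw_tilde_mult:
  assumes "coprime c p"
  shows "bij_betw (\<lambda>x. tilde p (c * x)) {1..p div 2} {1..p div 2}"
proof -
  obtain c' where inverse: "[c * c' = 1] (mod p)"
    using cong_solve_coprime_int[OF assms] by blast
  then have inverse': "[c' * c = 1] (mod p)" by (simp only: mult.commute)
  then have "coprime c' p"
    using coprime_iff_invertible_int by blast
  show ?thesis
    by (rule bij_betw_byWitness[where f' = "\<lambda>x. tilde p (c' * x)"])
      (use tilde_mult_inverse[OF inverse] tilde_mult_inverse[OF inverse']
        tilde_mult_in_half_range[OF assms] tilde_mult_in_half_range[OF \<open>coprime c' p\<close>]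
        in \<open>simp_all add: image_subset_iff\<close>)
qed

end

section \<open>The square of the half factorial\<close>

lemma fact_half_square_cong:
  fixes p :: nat
  assumes "prime p" and p_eq: "p = 2 * n + 1"
  shows "[(fact n)\<^sup>2 = (-1) ^ (n + 1)] (mod int p)"
proof -
  have "(fact (p - 1) :: int) = (\<Prod>i\<in>{1..n}. int i) * (\<Prod>i\<in>{n + 1..n + n}. int i)"
    using prod.ub_add_nat[of 1 n int n] by (simp add: p_eq fact_prod mult_2)
  also have "(\<Prod>i\<in>{n + 1..n + n}. int i) = (\<Prod>i\<in>{1..n}. int p - int i)"
    by (rule prod.reindex_bij_witness[of _ "\<lambda>i. p - i" "\<lambda>i. p - i"]) (auto simp: p_eq)
  finally have "fact (p - 1) = fact n * (\<Prod>i\<in>{1..n}. int p - int i)"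
    by (simp add: fact_prod)
  moreover have "[(\<Prod>i\<in>{1..n}. int p - int i) = (\<Prod>i\<in>{1..n}. - int i)] (mod int p)"
    by (rule cong_prod) (simp add: cong_iff_dvd_diff)
  then have "[(\<Prod>i\<in>{1..n}. int p - int i) = (-1) ^ n * fact n] (mod int p)"
    by (simp add: prod_uminus fact_prod)
  ultimately have "[fact (p - 1) = fact n * ((-1) ^ n * fact n)] (mod int p)"
    by (simp add: cong_scalar_left)
  then have "[fact n * ((-1) ^ n * fact n) = (-1 :: int)] (mod int p)"
    using wilson_theorem[OF \<open>prime p\<close>] cong_trans cong_sym by blast
  from cong_scalar_left[OF this, of "(-1) ^ n"] show ?thesis
    by (simp add: power2_eq_square algebra_simps flip: power_mult_distrib)
qed

lemma half_fact_square_cong: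
  assumes "prime p" and "[p = 1] (mod 4)"
  shows "[(half_fact p)\<^sup>2 = -1] (mod p)"
proof -
  have "p > 1" using \<open>prime p\<close> by (rule prime_gt_1_int)
  have "4 dvd p - 1" using assms(2) by (simp add: cong_iff_dvd_diff)
  then obtain j where "p - 1 = 4 * j" by (elim dvdE)
  moreover from this \<open>p > 1\<close> obtain k where "j = int k"
    using nonneg_int_cases[of j] by auto
  ultimately have p_eq: "p = 4 * int k + 1" by simp
  then have "nat p = 2 * (2 * k) + 1" by simp
  moreover have "half_fact p = fact (2 * k)"
    unfolding half_fact_def fact_prod of_nat_prod
    by (rule prod.reindex_bij_witness[of _ int nat]) (auto simp: p_eq)
  moreover have "prime (nat p)" using \<open>prime p\<close> prime_int_nat_transfer by blast
  ultimately show ?thesis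
    using fact_half_square_cong[of "nat p" "2 * k"] by (simp add: p_eq add.commute)
qed

section \<open>Multiplication by a square root of \<open>-1\<close>\<close>

lemma sum_squares_int:
  fixes n :: int
  assumes "0 \<le> n"
  shows "6 * (\<Sum>x\<in>{1..n}. x\<^sup>2) = n * (n + 1) * (2 * n + 1)"
  using assms
proof (induction n rule: int_ge_induct)
  case base
  show ?case by simp
next
  case (step i)
  have "{1..i + 1} = insert (i + 1) {1..i}" using step.hyps by auto
  then show ?case using step.IH by (simp add: algebra_simps power2_eq_square)
qed

locale sqrt_minus_one_mod =
  fixes p t :: int
  assumes p_pos: "0 < p" and odd_p: "odd p" and square_cong: "[t\<^sup>2 = -1] (mod p)"
begin

definition partner :: "int \<Rightarrow> int" where
  "partner x = tilde p (t * x)"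

lemma coprime_root: "coprime t p" "coprime (t - 1) p" "coprime (t + 1) p"
proof -
  have "coprime (t\<^sup>2) p"
    using cong_imp_coprime[OF cong_sym[OF square_cong]] by simp
  then show "coprime t p" by simp
  have "[(t - 1) * (t + 1) = - 2] (mod p)"
    using cong_diff[OF square_cong cong_refl[of 1]] by (simp add: power2_eq_square algebra_simps)
  then have "coprime ((t - 1) * (t + 1)) p"
    using odd_p cong_imp_coprime[OF cong_sym] by fastforce
  then show "coprime (t - 1) p" "coprime (t + 1) p" by simp_all
qed

lemma bij_betw_partner: "bij_betw partner {1..p div 2} {1..p div 2}"
  using bij_betw_tilde_mult[OF p_pos coprime_root(1)] by (simp add: partner_def[abs_def])

lemma partner_in_half_range: "x \<in> {1..p div 2} \<Longrightarrow> partner x \<in> {1..p div 2}"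
  using bij_betw_partner by (rule bij_betw_apply)

lemma partner_involutive:
  assumes "x \<in> {1..p div 2}"
  shows "partner (partner x) = x"
proof -
  have "partner (partner x) = tilde p (t\<^sup>2 * x)"
    by (simp add: partner_def tilde_mult_tilde power2_eq_square mult.assoc)
  also have "\<dots> = tilde p (- x)"
    using cong_scalar_right[OF square_cong, of x] by (intro tilde_cong) simp
  also have "\<dots> = x"
    using assms tilde_eq_self[OF p_pos] by (simp add: tilde_minus)
  finally show ?thesis .
qed

lemma partner_fixpoint_free:
  assumes "x \<in> {1..p div 2}"
  shows "partner x \<noteq> x"
proof
  assume "partner x = x"
  then have "[x = t * x] (mod p) \<or> [x = - (t * x)] (mod p)"
    using cong_tilde[of p "t * x"] by (simp add: partner_def)
  then have "p dvd (t - 1) * x \<or> p dvd (t + 1) * x"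
    by (auto simp: cong_iff_dvd_diff algebra_simps dvd_diff_commute)
  then have "p dvd x"
    using coprime_root by (auto simp: coprime_dvd_mult_right_iff coprime_commute)
  then show False using assms p_pos by (auto dest: zdvd_imp_le)
qed

sublocale interval_chord_diagram 1 "p div 2" partner
  by unfold_locales
    (simp_all only: finite_atLeastAtMost_int partner_in_half_range partner_involutive
      partner_fixpoint_free not_False_eq_True)

lemma sum_partner_diff_add:
  fixes f :: "int \<Rightarrow> 'b::semiring_1"
  shows "(\<Sum>x\<in>{1..p div 2}. f \<bar>partner x - x\<bar> + f (tilde p (partner x + x)))
    = 2 * (\<Sum>x\<in>{1..p div 2}. f x)"
proof -
  have reindex: "(\<Sum>x\<in>{1..p div 2}. f (tilde p (c * x))) = (\<Sum>x\<in>{1..p div 2}. f x)"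
    if "coprime c p" for c
    using bij_betw_tilde_mult[OF p_pos that] by (rule sum.reindex_bij_betw)
  have "f \<bar>partner x - x\<bar> + f (tilde p (partner x + x))
      = f (tilde p ((t - 1) * x)) + f (tilde p ((t + 1) * x))" if "x \<in> {1..p div 2}" for x
  proof -
    have "\<bar>partner x - x\<bar> = tilde p \<bar>partner x - x\<bar>"
      using that partner_in_half_range[OF that] by (intro tilde_eq_self[OF p_pos, symmetric]) auto
    also have "\<dots> = tilde p (partner x - x)"
      by (rule tilde_abs)
    finally show ?thesis
      using tilde_diff_add_tilde[of f p "t * x" x] by (simp add: partner_def algebra_simps)
  qed
  then have "(\<Sum>x\<in>{1..p div 2}. f \<bar>partner x - x\<bar> + f (tilde p (partner x + x)))
      = (\<Sum>x\<in>{1..p div 2}. f (tilde p ((t - 1) * x))) + (\<Sum>x\<in>{1..p div 2}. f (tilde p ((t + 1) * x)))"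
    by (simp add: sum.distrib)
  also have "\<dots> = 2 * (\<Sum>x\<in>{1..p div 2}. f x)"
    using coprime_root by (simp add: reindex mult_2)
  finally show ?thesis .
qed

lemma sum_partner_dist_eq_sum_squares:
  "p * (\<Sum>x\<in>{1..p div 2}. \<bar>partner x - x\<bar>) = 2 * (\<Sum>x\<in>{1..p div 2}. x\<^sup>2)"
proof -
  define g where "g y = y * (p - y)" for y
  define h where "h y = p * y - 2 * y\<^sup>2" for y
  let ?H = "{1..p div 2}" and ?d = "\<lambda>x. \<bar>partner x - x\<bar>"
  have pointwise: "g (?d x) + g (tilde p (partner x + x)) = p * ?d x + (h (partner x) + h x)"
    if "x \<in> ?H" for x
  proof -
    have "partner x + x \<in> {0..<p}"
      using that partner_in_half_range[OF that] odd_p by (auto elim!: oddE)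
    then have "g (tilde p (partner x + x)) = g (partner x + x)"
      unfolding g_def by (rule tilde_mult_diff_tilde[OF p_pos])
    moreover have "g (?d x) = p * ?d x - (partner x - x)\<^sup>2"
      by (simp add: g_def right_diff_distrib mult.commute flip: power2_eq_square)
    ultimately show ?thesis
      by (simp add: g_def h_def power2_eq_square algebra_simps)
  qed
  have "2 * (\<Sum>x\<in>?H. h x + x\<^sup>2) = 2 * (\<Sum>x\<in>?H. g x)"
    by (simp add: g_def h_def power2_eq_square algebra_simps)
  also have "\<dots> = (\<Sum>x\<in>?H. g (?d x) + g (tilde p (partner x + x)))"
    by (rule sum_partner_diff_add[symmetric])
  also have "\<dots> = (\<Sum>x\<in>?H. p * ?d x + (h (partner x) + h x))"
    by (rule sum.cong[OF refl pointwise])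
  also have "\<dots> = p * (\<Sum>x\<in>?H. ?d x) + 2 * (\<Sum>x\<in>?H. h x)"
    using sum.reindex_bij_betw[OF bij_betw_partner, of h]
    by (simp add: sum.distrib sum_distrib_left)
  finally show ?thesis by (simp add: sum.distrib)
qed

lemma sum_partner_dist:
  "3 * (\<Sum>x\<in>{1..p div 2}. \<bar>partner x - x\<bar>) = p div 2 * (p div 2 + 1)"
proof -
  define n where "n = p div 2"
  have "p * (3 * (\<Sum>x\<in>{1..n}. \<bar>partner x - x\<bar>)) = 6 * (\<Sum>x\<in>{1..n}. x\<^sup>2)"
    using sum_partner_dist_eq_sum_squares by (simp add: n_def)
  also have "\<dots> = n * (n + 1) * (2 * n + 1)"
    using p_pos by (intro sum_squares_int) (simp add: n_def)
  also have "2 * n + 1 = p"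
    unfolding n_def by (rule odd_two_times_div_two_succ[OF odd_p])
  finally show ?thesis using p_pos by (simp add: n_def mult.commute[of _ p])
qed

lemma card_crossing_nested: "real (card crossing) + real (card nested) = 2 * L p"
proof -
  define n where "n = p div 2"
  have p_eq: "p = 2 * n + 1" using odd_p by (simp add: n_def)
  have "12 * int (card crossing + card nested) = n * (n - 2)"
    using sum_abs_partner_diff sum_partner_dist p_pos by (simp add: n_def algebra_simps)
  from arg_cong[OF this, of real_of_int] show ?thesis
    by (simp add: L_def p_eq field_simps)
qed

lemma card_separated: "real (card separated) = L p"
proof -
  define k where "k = card left_endpoints"
  have "int (card {1..p div 2}) = 2 * int k"
    unfolding k_def by (simp only: card_points of_nat_mult of_nat_numeral)
  then have "p = 4 * int k + 1" using odd_p p_pos by (auto elim!: oddE)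
  moreover have "2 * real (k choose 2) = real k * (real k - 1)"
    by (cases k) (simp_all add: choose_two real_of_nat_div algebra_simps)
  ultimately have "real (k choose 2) = 3 * L p"
    by (simp add: L_def field_simps)
  then show ?thesis
    using arg_cong[OF card_pairs, of real] card_crossing_nested by (simp add: k_def)
qed

end

theorem theorem3p1:
  fixes p :: int
  assumes "prime p" and "[p = 1] (mod 4)"
  shows "real (card (Y_set p)) = L p \<and> real (card (X_set p)) + real (card (Z_set p)) = 2 * L p"
proof -
  have "p > 1" using assms(1) by (rule prime_gt_1_int)
  moreover have "odd p" using assms(2) unfolding cong_iff_dvd_diff by presburger
  ultimately interpret sqrt_minus_one_mod p "half_fact p"
    using half_fact_square_cong[OF assms] by unfold_locales simp_all
  have "(p - 1) div 2 = p div 2" using \<open>odd p\<close> by (auto elim!: oddE)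
  then have "V_set p = left_endpoints"
    by (auto simp: V_set_def left_endpoints_def partner_def)
  moreover have "bar p a = partner a" for a
    by (simp add: bar_def partner_def)
  ultimately have "X_set p = crossing" "Y_set p = separated" "Z_set p = nested"
    using left_endpoint_less by (auto simp: X_set_def Y_set_def Z_set_def pair_defs)
  then show ?thesis using card_separated card_crossing_nested by simp
qed

end
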